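(* Let $n \ge 1$ and let $Z$ be any finite binary string (the key, or seed). Write $EM_n(Z) = x_1x_2x_3\dots$. Then there is an $N \ge 0$ such that the string $X = x_{N+1}x_{N+2}\cdots x_{N+2^{n+1}+n}$ is a DeBruijn string of order $n+1$, and after this string the sequence continues as if $X$ had been the key: the infinite sequence $x_{N+2^{n+1}+n+1}\,x_{N+2^{n+1}+n+2}\dots$ equals $EM_n(X)$.
   Context: All strings are over the alphabet $\{0,1\}$; for a digit $y$, $y' = 1-y$. A DeBruijn string of order $m$ is a binary string of length $2^m+m-1$ that contains every binary string of length $m$ as a (contiguous) substring. Definition of $EM_n(Z)$ for $n\ge 1$ and a finite binary string $Z$: it is the infinite binary sequence $x_1x_2x_3\dots$ generated digit by digit as follows. Suppose $x_1,\dots,x_k$ ($k\ge 0$) have been generated and let $W = Zx_1\cdots x_k$ (concatenation). If $W$ is empty (i.e. $Z$ is empty and $k=0$), put $x_1 = 0$. Otherwise let $\sigma$ be the longest tail (suffix, possibly empty) of $W$ with $|\sigma|\le n$ that also occurs as a substring of $W$ with its last digit removed. Take the latest (rightmost) such earlier occurrence and let $y$ be the digit of $W$ immediately following it; if $\sigma$ is empty, the latest previous occurrence is understood to be just before the last digit of $W$, so $y$ is the last digit of $W$. Then $x_{k+1} = y'$. The sequence $EM_n(Z)$ does not include the seed $Z$. *)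

theory Defs
  imports Main "HOL-Library.Sublist"
begin

text \<open>Binary strings are of type \<^typ>\<open>bool list\<close>: the digit 0 is \<^term>\<open>False\<close>, the digit 1 is
  \<^term>\<open>True\<close>, and complementing a digit is \<^term>\<open>Not\<close>. ``Substring'' and ``tail'' are the library's
  \<^const>\<open>sublist\<close> (contiguous) and \<^const>\<open>suffix\<close>.\<close>

definition debruijn_string :: "nat \<Rightarrow> bool list \<Rightarrow> bool" where
  "debruijn_string m X \<longleftrightarrow>
     length X = 2 ^ m + m - 1 \<and> (\<forall>s. length s = m \<longrightarrow> sublist s X)"

definition occurs_at :: "bool list \<Rightarrow> nat \<Rightarrow> bool list \<Rightarrow> bool" where
  "occurs_at s i V \<longleftrightarrow> i + length s \<le> length V \<and> take (length s) (drop i V) = s"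

text \<open>For \<^term>\<open>W \<noteq> []\<close> the longest tail is unique (a suffix is determined by its length) and exists
  (the empty tail qualifies).\<close>

definition longest_tail :: "nat \<Rightarrow> bool list \<Rightarrow> bool list" where
  "longest_tail n W =
     (ARG_MAX length s. suffix s W \<and> length s \<le> n \<and> sublist s (butlast W))"

definition latest_occurrence :: "bool list \<Rightarrow> bool list \<Rightarrow> nat" where
  "latest_occurrence s W = (GREATEST i. occurs_at s i (butlast W))"

text \<open>If the longest tail is empty, its latest occurrence in \<^term>\<open>butlast W\<close> starts at
  \<^term>\<open>length W - 1\<close>, so the digit following it is the last digit of \<^term>\<open>W\<close>.\<close>

definition EM_next :: "nat \<Rightarrow> bool list \<Rightarrow> bool" where
  "EM_next n W =
     (if W = [] then False
      else let s = longest_tail n W in \<not> W ! (latest_occurrence s W + length s))"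

fun EM_prefix :: "nat \<Rightarrow> bool list \<Rightarrow> nat \<Rightarrow> bool list" where
  "EM_prefix n Z 0 = []"
| "EM_prefix n Z (Suc k) = EM_prefix n Z k @ [EM_next n (Z @ EM_prefix n Z k)]"

text \<open>Sequences are indexed from 0: \<^term>\<open>EM n Z k\<close> is the digit $x_{k+1}$.\<close>

definition EM :: "nat \<Rightarrow> bool list \<Rightarrow> nat \<Rightarrow> bool" where
  "EM n Z k = EM_next n (Z @ EM_prefix n Z k)"

end

theory Submission
  imports Defs "HOL-Library.Infinite_Set"
begin

text \<open>The words of length \<open>n\<close> are the vertices of a de Bruijn graph and the words of length
  \<open>n + 1\<close> its edges. As soon as a word of length \<open>n\<close> has occurred, its two exits are used
  alternately, so the sequence is a rotor walk. Both successors of a vertex visited infinitely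
  often are visited infinitely often, hence eventually every vertex has been visited. Let \<open>N\<close> be
  any later time. The edges by which the other vertices were last left before time \<open>N\<close> form a
  spanning tree directed towards the vertex at time \<open>N\<close>, and each of them is the second exit to
  be used from time \<open>N\<close> on. The first edge to be repeated after time \<open>N\<close> leaves the vertex at time
  \<open>N\<close>, both of whose incoming edges have then been used; going backwards along the tree, all
  edges have been used. So the walk from time \<open>N\<close> on starts with an Eulerian circuit.\<close>

section \<open>Vertices and edges as factors of a sequence\<close>

definition factor :: "(nat \<Rightarrow> 'a) \<Rightarrow> nat \<Rightarrow> nat \<Rightarrow> 'a list" where
  "factor w m t = map w [t..<t + m]"

lemma length_factor [simp]: "length (factor w m t) = m"
  by (simp add: factor_def)

lemma factor_Suc: "factor w (Suc m) t = factor w m t @ [w (t + m)]"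
  by (simp add: factor_def)

text \<open>Together with \<open>factor_Suc\<close> this reads an edge in two ways: as the vertex
  left with the exit digit, or as the entry digit with the vertex reached.\<close>

lemma factor_Suc': "factor w (Suc m) t = w t # factor w m (Suc t)"
  by (simp add: factor_def upt_conv_Cons del: upt_Suc)

lemma upt_split: "\<lbrakk>i \<le> j; j \<le> k\<rbrakk> \<Longrightarrow> [i..<k] = [i..<j] @ [j..<k]"
  using upt_add_eq_append[of i j "k - j"] by simp

lemma take_drop_map_upt:
  "s + m \<le> L \<Longrightarrow> take m (drop s (map w [0..<L])) = factor w m s"
  by (simp add: factor_def drop_map take_map)

lemma card_bool_lists: "card {s :: bool list. length s = m} = 2 ^ m"
  using card_lists_length_eq[of "UNIV :: bool set" m] by simp

lemma finite_bool_lists: "finite {s :: bool list. length s = m}"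
  using finite_lists_length_eq[of "UNIV :: bool set" m] by simp

section \<open>Rotor walks on the de Bruijn graph\<close>

text \<open>Here \<open>s\<close> is the latest visit before \<open>t\<close> to the vertex at
  \<open>t\<close>. Only \<open>t\<close> is bounded below by \<open>t0\<close>: the earlier visit
  may lie in the seed, where the digits are arbitrary.\<close>

locale alternating_exits =
  fixes w :: "nat \<Rightarrow> bool" and n t0 :: nat
  assumes alternate: "\<lbrakk>t0 \<le> t; s < t; factor w n s = factor w n t;
      \<And>r. \<lbrakk>s < r; r < t\<rbrakk> \<Longrightarrow> factor w n r \<noteq> factor w n t\<rbrakk> \<Longrightarrow> w (t + n) \<noteq> w (s + n)"
begin

lemma last_visit:
  assumes "s < t" "factor w n s = y"
  obtains q where "s \<le> q" "q < t" "factor w n q = y"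
    "\<And>r. \<lbrakk>q < r; r < t\<rbrakk> \<Longrightarrow> factor w n r \<noteq> y"
proof -
  let ?P = "\<lambda>q. q < t \<and> factor w n q = y"
  have b: "\<forall>q. ?P q \<longrightarrow> q \<le> t" by simp
  have P: "?P (Greatest ?P)" using GreatestI_nat[of ?P s t] assms b by auto
  have le: "q \<le> Greatest ?P" if "?P q" for q
    using Greatest_le_nat[of ?P q t] that b by auto
  show ?thesis
  proof (rule that[of "Greatest ?P"])
    show "s \<le> Greatest ?P" using le assms by blast
    show "factor w n r \<noteq> y" if "Greatest ?P < r" "r < t" for r
      using le[of r] that by auto
  qed (use P in auto)
qed

text \<open>Consecutive visits to \<open>u\<close> leave by different exits, so each exit is taken
  infinitely often.\<close>

lemma infinite_successor:
  assumes inf: "infinite {t. factor w n t = u}" and n: "n \<ge> 1"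
  shows "infinite {t. factor w n t = tl u @ [b]}"
proof -
  have "\<exists>t>m. factor w n t = tl u @ [b]" for m
  proof -
    obtain s where s: "s > max m t0" "factor w n s = u"
      using inf unfolding infinite_nat_iff_unbounded by blast
    obtain t where t: "t > s" "factor w n t = u"
      using inf unfolding infinite_nat_iff_unbounded by blast
    obtain q where q: "s \<le> q" "q < t" "factor w n q = u"
      "\<And>r. \<lbrakk>q < r; r < t\<rbrakk> \<Longrightarrow> factor w n r \<noteq> u"
      using last_visit[OF t(1) s(2)] by blast
    have "w (t + n) \<noteq> w (q + n)"
      by (rule alternate) (use s t q in auto)
    \<comment> \<open>As the two exit digits differ, one of the visits \<open>q\<close> and
      \<open>t\<close> leaves by \<open>b\<close>.\<close>
    then obtain p where p: "p > m" "factor w n p = u" "w (p + n) = b"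
      using s q t by (metis (full_types) max_less_iff_conj order_less_le_trans less_trans)
    have "w p # factor w n (Suc p) = u @ [b]"
      using factor_Suc[of w n p] factor_Suc'[of w n p] p by simp
    moreover have "u \<noteq> []" using p(2) n by (metis length_factor list.size(3) not_one_le_zero)
    ultimately have "factor w n (Suc p) = tl u @ [b]"
      by (metis list.sel(3) tl_append2)
    then show ?thesis using p(1) less_SucI by blast
  qed
  then show ?thesis unfolding infinite_nat_iff_unbounded by blast
qed

text \<open>Some vertex \<open>u\<close> recurs by the pigeonhole principle, and shifting in the
  digits of \<open>y\<close> one at a time leads from \<open>u\<close> to \<open>y\<close>.\<close>

lemma infinite_visits:
  assumes n: "n \<ge> 1" and y: "length y = n"
  shows "infinite {t. factor w n t = y}"
proof -
  have "\<exists>u\<in>{s. length s = n}. \<not> finite {t \<in> UNIV. factor w n t = u}"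
    by (rule pigeonhole_infinite_rel) (auto simp: finite_bool_lists)
  then obtain u where u: "infinite {t. factor w n t = u}" "length u = n" by auto
  have "k \<le> n \<Longrightarrow> infinite {t. factor w n t = drop k u @ take k y}" for k
  proof (induction k)
    case (Suc k)
    have "tl (drop k u @ take k y) @ [y ! k] = drop (Suc k) u @ take (Suc k) y"
      using Suc.prems u(2) y by (simp add: take_Suc_conv_app_nth drop_Suc tl_drop)
    then show ?case using infinite_successor[OF _ n] Suc by (metis Suc_leD)
  qed (use u in simp)
  from this[of n] show ?thesis using u y by simp
qed

text \<open>\<open>T\<close> is the time of the first repeated edge. By then every edge lies in
  \<open>?E\<close>, so at least as many steps as edges have passed.\<close>

lemma first_repetition:
  assumes n: "n \<ge> 1" and N: "t0 \<le> N"
    and visited: "\<And>y. length y = n \<Longrightarrow> \<exists>s<N. factor w n s = y"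
    and inj: "inj_on (factor w (Suc n)) {N..<T}"
    and rep: "factor w (Suc n) T \<in> factor w (Suc n) ` {N..<T}"
  shows "2 ^ Suc n \<le> T - N"
proof -
  let ?v = "factor w n" and ?E = "factor w (Suc n) ` {N..<T}"
  have entry: "w (p - 1) # ?v p \<in> ?E" if "N < p" "p \<le> T" for p
  proof -
    have "w (p - 1) # ?v p = factor w (Suc n) (p - 1)" using that by (simp add: factor_Suc')
    moreover have "p - 1 \<in> {N..<T}" using that by auto
    ultimately show ?thesis by (simp only: imageI)
  qed
  have entries_differ: "w (p - 1) \<noteq> w (q - 1)"
    if "?v p = ?v q" "N < p" "p < q" "q \<le> T" for p q
  proof -
    have "p - 1 \<in> {N..<T}" "q - 1 \<in> {N..<T}" "p - 1 \<noteq> q - 1" using that by auto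
    then have "factor w (Suc n) (p - 1) \<noteq> factor w (Suc n) (q - 1)"
      using inj_onD[OF inj] by metis
    then show ?thesis using that by (simp add: factor_Suc')
  qed
  have two_entries: "b # ?v p \<in> ?E"
    if "?v p = ?v q" "N < p" "p < q" "q \<le> T" for p q b
    using entries_differ[OF that] entry[of p] entry[of q] that
    by (cases "b = w (p - 1)") (auto dest: sym)
  obtain r where r: "N \<le> r" "r < T" "factor w (Suc n) r = factor w (Suc n) T" using rep by auto
  then have vr: "?v r = ?v T" "w (r + n) = w (T + n)" by (auto simp: factor_Suc)
  obtain q where q: "r \<le> q" "q < T" "?v q = ?v T"
    "\<And>r. \<lbrakk>q < r; r < T\<rbrakk> \<Longrightarrow> ?v r \<noteq> ?v T"
    using last_visit[OF r(2) vr(1)] by blast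
  have "w (T + n) \<noteq> w (q + n)"
    by (rule alternate) (use N r q in auto)
  \<comment> \<open>The exit at \<open>T\<close> equals that at \<open>r\<close> but differs from
    that at \<open>q\<close>, so the vertex has three visits \<open>r\<close>, \<open>q\<close>,
    \<open>T\<close>.\<close>
  then have rq: "r < q" using q(1) vr(2) by (cases "q = r") auto
  \<comment> \<open>Otherwise the three visits would have been entered by three different edges, but
    a vertex has only two.\<close>
  have "r = N"
  proof (rule ccontr)
    assume "r \<noteq> N"
    then have N_r: "N < r" using r by simp
    then show False
      using entries_differ[of r q] entries_differ[of r T] entries_differ[of q T] rq q vr by auto
  qed
  then have vN: "b # ?v N \<in> ?E" for b
    using two_entries[of q T b] rq q vr by simp
  \<comment> \<open>A last visit \<open>s\<close> before \<open>N\<close> defines a tree edge. The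
    induction goes backwards in time, since the last visit to the vertex at \<open>Suc s\<close> is
    later than \<open>s\<close>.\<close>
  have tree: "b # ?v s \<in> ?E" if "s < N" "\<And>r. \<lbrakk>s < r; r < N\<rbrakk> \<Longrightarrow> ?v r \<noteq> ?v s" for s b
    using that
  proof (induction "N - s" arbitrary: s b rule: less_induct)
    case less
    have "c # ?v (Suc s) \<in> ?E" for c
    proof (cases "Suc s = N")
      case False
      then have "Suc s < N" using less.prems by simp
      then obtain s' where s': "Suc s \<le> s'" "s' < N" "?v s' = ?v (Suc s)"
        "\<And>r. \<lbrakk>s' < r; r < N\<rbrakk> \<Longrightarrow> ?v r \<noteq> ?v (Suc s)"
        using last_visit[of "Suc s" N "?v (Suc s)"] by blast
      have "c # ?v s' \<in> ?E"
        by (rule less.hyps) (use s' in auto)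
      then show ?thesis using s' by simp
    qed (use vN in simp)
    \<comment> \<open>All entries of the next vertex have been used after \<open>N\<close>, the tree
      edge from \<open>s\<close> among them.\<close>
    then have "factor w (Suc n) s \<in> ?E" by (metis factor_Suc')
    then obtain p where p: "N \<le> p" "p < T" "factor w (Suc n) s = factor w (Suc n) p" by auto
    then have vp: "?v p = ?v s" "w (p + n) = w (s + n)" by (auto simp: factor_Suc)
    show ?case
    proof (cases "?v s = ?v N")
      case False
      then have "N < p" using p vp by (metis nat_less_le)
      obtain p1 where p1: "s \<le> p1" "p1 < p" "?v p1 = ?v s"
        "\<And>r. \<lbrakk>p1 < r; r < p\<rbrakk> \<Longrightarrow> ?v r \<noteq> ?v s"
        using last_visit[of s p "?v s"] less.prems p by (metis order_less_le_trans)
      have "w (p + n) \<noteq> w (p1 + n)"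
        by (rule alternate) (use N p p1 vp in auto)
      \<comment> \<open>The tree edge is used at \<open>s\<close> and again at \<open>p\<close>, so
        by alternation another visit \<open>p1\<close> lies between. It comes after
        \<open>N\<close>, because \<open>s\<close> was the last visit before \<open>N\<close>; hence
        \<open>p1\<close> and \<open>p\<close> supply both entries.\<close>
      then have "s < p1" using p1 vp by (metis nat_less_le)
      then have "N < p1" using less.prems(2)[of p1] p1(3) False
        by (metis linorder_neqE_nat)
      then show ?thesis using two_entries[of p1 p b] p1 p vp by simp
    qed (use vN in simp)
  qed
  have "{s. length s = Suc n} \<subseteq> ?E"
  proof
    fix e :: "bool list" assume "e \<in> {s. length s = Suc n}"
    then obtain b y where e: "e = b # y" "length y = n" by (auto simp: length_Suc_conv)
    obtain s where s: "s < N" "?v s = y" using visited[OF e(2)] by blast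
    obtain s' where s': "s' < N" "?v s' = y" "\<And>r. \<lbrakk>s' < r; r < N\<rbrakk> \<Longrightarrow> ?v r \<noteq> y"
      using last_visit[OF s] by blast
    show "e \<in> ?E" using tree[of s' b] s' e by simp
  qed
  then have "card {s :: bool list. length s = Suc n} \<le> card ?E" by (intro card_mono) auto
  also have "\<dots> \<le> T - N" using card_image_le[of "{N..<T}" "factor w (Suc n)"] by simp
  finally show ?thesis by (simp only: card_bool_lists)
qed

text \<open>No edge repeats within the first \<open>2 ^ Suc n\<close> steps, and this is the number
  of all edges.\<close>

lemma eulerian_circuit:
  assumes n: "n \<ge> 1" and N: "t0 \<le> N"
    and visited: "\<And>y. length y = n \<Longrightarrow> \<exists>s<N. factor w n s = y"
  shows "factor w (Suc n) ` {N..<N + 2 ^ Suc n} = {s. length s = Suc n}"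
proof -
  have inj: "inj_on (factor w (Suc n)) {N..<N + k}" if "k \<le> 2 ^ Suc n" for k
    using that
  proof (induction k)
    case (Suc k)
    then have IH: "inj_on (factor w (Suc n)) {N..<N + k}" by simp
    have "factor w (Suc n) (N + k) \<notin> factor w (Suc n) ` {N..<N + k}"
      using first_repetition[OF n N visited IH] Suc.prems by auto
    then show ?case using IH by (simp add: atLeastLessThanSuc)
  qed simp
  show ?thesis
    by (rule card_subset_eq)
      (auto simp: finite_bool_lists card_bool_lists card_image[OF inj[OF order_refl]] simp del: power_Suc)
qed

lemma eventually_all_visited:
  assumes n: "n \<ge> 1"
  obtains N where "t0 \<le> N" "\<And>y. length y = n \<Longrightarrow> \<exists>s<N. factor w n s = y"
proof -
  have "\<forall>y\<in>{y. length y = n}. \<exists>s. factor w n s = y"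
    using infinite_visits[OF n] not_finite_existsD by blast
  then obtain g where g: "\<And>y. length y = n \<Longrightarrow> factor w n (g y) = y"
    using bchoice[of "{y. length y = n}" "\<lambda>y s. factor w n s = y"] by auto
  show ?thesis
  proof (rule that[of "t0 + Suc (Max (g ` {y. length y = n}))"])
    fix y :: "bool list" assume y: "length y = n"
    then have "g y \<le> Max (g ` {y. length y = n})" by (simp add: finite_bool_lists)
    then show "\<exists>s<t0 + Suc (Max (g ` {y. length y = n})). factor w n s = y"
      using g[OF y] by (intro exI[of _ "g y"]) auto
  qed simp
qed

end

section \<open>Evaluating the generating rule\<close>

lemma occurs_at_butlast:
  "occurs_at s i (butlast W) \<longleftrightarrow> i + length s < length W \<and> take (length s) (drop i W) = s"
  if "W \<noteq> []"
proof -
  have "take (length s) (drop i (butlast W)) = take (length s) (drop i W)"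
    if "i + length s < length W"
    using that by (simp add: butlast_conv_take drop_take)
  moreover have "i + length s \<le> length (butlast W) \<longleftrightarrow> i + length s < length W"
    using that by (cases W rule: rev_cases) auto
  ultimately show ?thesis unfolding occurs_at_def by metis
qed

lemma occurs_at_imp_sublist: "occurs_at s i V \<Longrightarrow> sublist s V"
  unfolding occurs_at_def by (metis sublist_drop sublist_order.order_trans sublist_take)

text \<open>A tail of the maximal length \<open>n\<close> that has occurred before is the longest
  admissible one; \<open>i + n < length W\<close> says that the occurrence lies in
  \<open>butlast W\<close>.\<close>

lemma EM_next_eq:
  assumes u: "u = drop (length W - n) W" and i: "i + n < length W" "take n (drop i W) = u"
    and last: "\<And>j. \<lbrakk>i < j; j + n < length W\<rbrakk> \<Longrightarrow> take n (drop j W) \<noteq> u"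
  shows "EM_next n W = (\<not> W ! (i + n))"
proof -
  have W: "W \<noteq> []" and lu: "length u = n" using i u by auto
  have occ: "occurs_at u j (butlast W) \<longleftrightarrow> j + n < length W \<and> take n (drop j W) = u" for j
    using occurs_at_butlast[OF W, of u j] lu by simp
  let ?P = "\<lambda>s. suffix s W \<and> length s \<le> n \<and> sublist s (butlast W)"
  have Pu: "?P u" using occurs_at_imp_sublist[of u i] occ i u lu by (auto simp: suffix_drop)
  have "longest_tail n W = u"
  proof -
    have "?P (longest_tail n W) \<and> (\<forall>s. ?P s \<longrightarrow> length s \<le> length (longest_tail n W))"
      unfolding longest_tail_def using arg_max_nat_lemma[of ?P u length "Suc n"] Pu by auto
    then show ?thesis using Pu lu
      by (metis le_antisym suffix_length_suffix suffix_order.antisym)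
  qed
  moreover have "latest_occurrence u W = i"
    unfolding latest_occurrence_def
  proof (rule Greatest_equality)
    show "occurs_at u i (butlast W)" using occ i by simp
    show "j \<le> i" if "occurs_at u j (butlast W)" for j
      using that occ last[of j] by (meson linorder_not_le)
  qed
  ultimately show ?thesis using W lu by (simp add: EM_next_def Let_def)
qed

text \<open>The latest earlier occurrence of the tail already lies in \<open>V\<close>; putting
  \<open>P\<close> in front only shifts it.\<close>

lemma EM_next_append:
  assumes "i + n < length V" "take n (drop i V) = drop (length V - n) V"
  shows "EM_next n (P @ V) = EM_next n V"
proof -
  let ?u = "drop (length V - n) V"
  let ?Q = "\<lambda>i. i + n < length V \<and> take n (drop i V) = ?u"
  define g where "g = Greatest ?Q"
  have b: "\<forall>q. ?Q q \<longrightarrow> q \<le> length V" by simp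
  have g: "?Q g" unfolding g_def using GreatestI_nat[of ?Q i "length V"] assms b by auto
  have le: "j \<le> g" if "?Q j" for j
    unfolding g_def using Greatest_le_nat[of ?Q j "length V"] that b by auto
  have "EM_next n V = (\<not> V ! (g + n))"
  proof (rule EM_next_eq[OF refl])
    fix j assume "g < j" "j + n < length V"
    then show "take n (drop j V) \<noteq> ?u" using le[of j] by auto
  qed (use g in auto)
  moreover have "EM_next n (P @ V) = (\<not> (P @ V) ! (length P + g + n))"
  proof (rule EM_next_eq)
    have "length (P @ V) - n = length P + (length V - n)" using g by simp
    then show "?u = drop (length (P @ V) - n) (P @ V)" by simp
    fix j assume j: "length P + g < j" "j + n < length (P @ V)"
    then have "\<not> ?Q (j - length P)" using le[of "j - length P"] by auto
    then show "take n (drop j (P @ V)) \<noteq> ?u" using j by auto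
  qed (use g in auto)
  ultimately show ?thesis by (simp add: nth_append add.assoc)
qed

section \<open>The generated sequence as a rotor walk\<close>

lemma EM_prefix_eq_map: "EM_prefix n Z k = map (EM n Z) [0..<k]"
  by (induction k) (auto simp: EM_def)

lemma EM_eq: "EM n Z k = EM_next n (Z @ map (EM n Z) [0..<k])"
  by (simp add: EM_def EM_prefix_eq_map)

text \<open>The seed is included because the rule also looks back into it, and vertices may straddle
  its end.\<close>

definition EM_word :: "nat \<Rightarrow> bool list \<Rightarrow> nat \<Rightarrow> bool" where
  "EM_word n Z i = (if i < length Z then Z ! i else EM n Z (i - length Z))"

lemma map_EM_word: "map (EM_word n Z) [length Z + a..<length Z + b] = map (EM n Z) [a..<b]"
  by (rule nth_equalityI) (auto simp: EM_word_def)

lemma map_EM_word_0: "map (EM_word n Z) [0..<length Z + k] = Z @ map (EM n Z) [0..<k]"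
  by (rule nth_equalityI) (auto simp: EM_word_def nth_append)

lemma EM_word_eq:
  assumes "length Z \<le> t"
  shows "EM_word n Z t = EM_next n (map (EM_word n Z) [0..<t])"
proof -
  obtain k where t: "t = length Z + k" using assms le_Suc_ex by blast
  show ?thesis unfolding t map_EM_word_0 by (simp add: EM_word_def EM_eq[symmetric])
qed

lemma alternating_exits_EM_word: "alternating_exits (EM_word n Z) n (length Z)"
proof
  fix t s
  let ?w = "EM_word n Z"
  let ?W = "map ?w [0..<t + n]"
  assume t: "length Z \<le> t" "s < t" and st: "factor ?w n s = factor ?w n t"
    and last: "\<And>r. \<lbrakk>s < r; r < t\<rbrakk> \<Longrightarrow> factor ?w n r \<noteq> factor ?w n t"
  have "EM_next n ?W = (\<not> ?W ! (s + n))"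
  proof (rule EM_next_eq)
    show "factor ?w n t = drop (length ?W - n) ?W" by (simp add: factor_def drop_map)
    show "take n (drop s ?W) = factor ?w n t" using t st by (simp only: take_drop_map_upt)
    show "take n (drop j ?W) \<noteq> factor ?w n t" if "s < j" "j + n < length ?W" for j
      using that last[of j] by (simp add: take_drop_map_upt)
  qed (use t in simp)
  then show "?w (t + n) \<noteq> ?w (s + n)" using EM_word_eq[of Z "t + n" n] t by simp
qed

text \<open>Every word of length \<open>n\<close> has an occurrence in \<open>X\<close> with a digit
  after it, so what precedes \<open>X\<close> has no influence on later digits.\<close>

lemma EM_continue:
  assumes X: "X = map (EM n Z) [N..<M]" and "N \<le> M"
    and all: "\<And>s. length s = Suc n \<Longrightarrow> sublist s X"
  shows "EM n Z (M + k) = EM n X k"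
proof (induction k rule: less_induct)
  case (less k)
  let ?V = "X @ map (EM n X) [0..<k]"
  have "[0..<M + k] = [0..<N] @ [N..<M] @ [M..<M + k]"
    using \<open>N \<le> M\<close> upt_split[of 0 N "M + k"] upt_split[of N M "M + k"] by simp
  moreover have "map (EM n Z) [M..<M + k] = map (EM n X) [0..<k]"
    by (rule nth_equalityI) (use less in auto)
  ultimately have W: "Z @ map (EM n Z) [0..<M + k] = (Z @ map (EM n Z) [0..<N]) @ ?V"
    using X by simp
  let ?u = "drop (length ?V - n) ?V"
  have "sublist (replicate (Suc n) True) X" by (rule all) simp
  then have lX: "n < length X" using sublist_length_le by fastforce
  then have lu: "length ?u = n" by simp
  \<comment> \<open>The extra digit guarantees an occurrence other than the tail itself, even for
    \<open>k = 0\<close>.\<close>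
  then have "sublist (?u @ [True]) X" using all by simp
  then obtain a b where ab: "X = a @ (?u @ [True]) @ b" unfolding sublist_def by blast
  have "EM_next n ((Z @ map (EM n Z) [0..<N]) @ ?V) = EM_next n ?V"
  proof (rule EM_next_append[of "length a"])
    show "length a + n < length ?V" using arg_cong[OF ab, of length] lu by simp
    have "?V = a @ ?u @ ([True] @ b @ map (EM n X) [0..<k])" using ab by simp
    then have "take n (drop (length a) ?V) = take n (?u @ ([True] @ b @ map (EM n X) [0..<k]))"
      by (metis append_eq_conv_conj)
    then show "take n (drop (length a) ?V) = ?u" using lu by (metis append_eq_conv_conj)
  qed
  then show ?case unfolding EM_eq[of n Z "M + k"] EM_eq[of n X k] W .
qed

theorem theorem3p1:
  fixes n :: nat and Z :: "bool list"
  assumes "n \<ge> 1"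
  shows "\<exists>N X. X = map (EM n Z) [N..<N + 2 ^ (n + 1) + n] \<and>
           debruijn_string (n + 1) X \<and>
           (\<forall>k. EM n Z (N + 2 ^ (n + 1) + n + k) = EM n X k)"
proof -
  interpret alternating_exits "EM_word n Z" n "length Z" by (rule alternating_exits_EM_word)
  let ?w = "EM_word n Z"
  obtain N0 where N0: "length Z \<le> N0" "\<And>y. length y = n \<Longrightarrow> \<exists>s<N0. factor ?w n s = y"
    using eventually_all_visited[OF assms] by blast
  \<comment> \<open>\<open>N0\<close> counts positions of the word with its seed, \<open>N\<close>
    those of the sequence alone.\<close>
  define N where "N = N0 - length Z"
  define M where "M = N + 2 ^ (n + 1) + n"
  define X where "X = map (EM n Z) [N..<M]"
  have X: "X = map ?w [N0..<N0 + 2 ^ Suc n + n]"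
    unfolding X_def M_def using map_EM_word[of n Z N "N + 2 ^ (n + 1) + n"] N0(1)
    by (simp add: N_def algebra_simps)
  have all: "sublist s X" if "length s = Suc n" for s
  proof -
    have "s \<in> factor ?w (Suc n) ` {N0..<N0 + 2 ^ Suc n}"
      using eulerian_circuit[OF assms N0] that by blast
    then obtain t where t: "N0 \<le> t" "t < N0 + 2 ^ Suc n" "s = factor ?w (Suc n) t" by auto
    let ?M = "N0 + 2 ^ Suc n + n"
    \<comment> \<open>The last edge starts at \<open>N0 + 2 ^ Suc n - 1\<close> and has
      \<open>n + 1\<close> digits, so it ends exactly where \<open>X\<close> does.\<close>
    have "[N0..<?M] = [N0..<t] @ [t..<t + Suc n] @ [t + Suc n..<?M]"
      using t(1,2) by (subst upt_split[of N0 t], simp, simp, subst upt_split[of t "t + Suc n"]) simp_all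
    then show ?thesis unfolding X t(3) factor_def by (simp only: map_append sublist_appendI)
  qed
  have "debruijn_string (n + 1) X"
    using all by (simp add: debruijn_string_def X_def M_def)
  moreover have "EM n Z (M + k) = EM n X k" for k
    by (rule EM_continue[OF X_def _ all]) (simp_all add: M_def)
  ultimately show ?thesis unfolding X_def M_def by blast
qed

end
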